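(* Let $(\mathfrak g,\mu,T,B)$ be a quadratic Hom-Lie algebra over $\mathbb F$ with $T$ in its centroid. Define $[\,\cdot\,,\,\cdot\,]:\mathfrak g\times\mathfrak g\to\mathfrak g$ by $[x,y]=T(\mu(x,y))$ for all $x,y\in\mathfrak g$. Then $(\mathfrak g,[\,\cdot\,,\,\cdot\,],B)$ is a quadratic Lie algebra, and $T([x,y])=[T(x),y]$ for all $x,y\in\mathfrak g$.
   Context: All vector spaces are finite dimensional over an algebraically closed field $\mathbb F$ of characteristic zero. A Hom-Lie algebra is a triple $(\mathfrak g,\mu,T)$ with $\mathfrak g$ a vector space, $\mu:\mathfrak g\times\mathfrak g\to\mathfrak g$ bilinear and skew-symmetric, and $T:\mathfrak g\to\mathfrak g$ linear (the twist map), such that $\mu(T(x),\mu(y,z))+\mu(T(y),\mu(z,x))+\mu(T(z),\mu(x,y))=0$ for all $x,y,z\in\mathfrak g$. The product $\mu$ is not assumed to satisfy the Jacobi identity. $T$ is in the centroid (is a centroid) of $(\mathfrak g,\mu)$ if $T(\mu(x,y))=\mu(T(x),y)$ for all $x,y\in\mathfrak g$. A quadratic Hom-Lie algebra $(\mathfrak g,\mu,T,B)$ is a Hom-Lie algebra $(\mathfrak g,\mu,T)$ with a symmetric non-degenerate bilinear form $B:\mathfrak g\times\mathfrak g\to\mathbb F$ such that $B(\mu(x,y),z)=B(x,\mu(y,z))$ and $B(T(x),y)=B(x,T(y))$ for all $x,y,z\in\mathfrak g$. A quadratic Lie algebra $(\mathfrak g,[\,\cdot\,,\,\cdot\,],B)$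 is a Lie algebra with a symmetric non-degenerate bilinear form $B$ such that $B([x,y],z)=B(x,[y,z])$ for all $x,y,z$. *)

theory Defs
  imports "HOL-Computational_Algebra.Polynomial"
begin

text \<open>
  A vector space is given, as in \<^theory>\<open>HOL.Vector_Spaces\<close>, by a type of vectors together with
  a scalar multiplication. The library locale for finite dimension has a chosen basis as a
  parameter; here the basis is quantified existentially (the zero space is included).
\<close>

definition fin_dim_vector_space :: "('f::field \<Rightarrow> 'v::ab_group_add \<Rightarrow> 'v) \<Rightarrow> bool" where
  "fin_dim_vector_space scale \<longleftrightarrow> (\<exists>Basis. finite_dimensional_vector_space scale Basis)"

definition bilinear_map ::
  "('f::field \<Rightarrow> 'v::ab_group_add \<Rightarrow> 'v) \<Rightarrow> ('f \<Rightarrow> 'w::ab_group_add \<Rightarrow> 'w) \<Rightarrow> ('v \<Rightarrow> 'v \<Rightarrow> 'w) \<Rightarrow> bool"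
where
  "bilinear_map scale scale' f \<longleftrightarrow>
     (\<forall>x. Vector_Spaces.linear scale scale' (\<lambda>y. f x y)) \<and>
     (\<forall>y. Vector_Spaces.linear scale scale' (\<lambda>x. f x y))"

definition hom_lie_algebra ::
  "('f::field \<Rightarrow> 'v::ab_group_add \<Rightarrow> 'v) \<Rightarrow> ('v \<Rightarrow> 'v \<Rightarrow> 'v) \<Rightarrow> ('v \<Rightarrow> 'v) \<Rightarrow> bool"
where
  "hom_lie_algebra scale \<mu> T \<longleftrightarrow>
     fin_dim_vector_space scale \<and>
     bilinear_map scale scale \<mu> \<and>
     (\<forall>x y. \<mu> x y = - \<mu> y x) \<and>
     Vector_Spaces.linear scale scale T \<and>
     (\<forall>x y z. \<mu> (T x) (\<mu> y z) + \<mu> (T y) (\<mu> z x) + \<mu> (T z) (\<mu> x y) = 0)"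

definition in_centroid :: "('v \<Rightarrow> 'v \<Rightarrow> 'v) \<Rightarrow> ('v \<Rightarrow> 'v) \<Rightarrow> bool" where
  "in_centroid \<mu> T \<longleftrightarrow> (\<forall>x y. T (\<mu> x y) = \<mu> (T x) y)"

definition lie_algebra ::
  "('f::field \<Rightarrow> 'v::ab_group_add \<Rightarrow> 'v) \<Rightarrow> ('v \<Rightarrow> 'v \<Rightarrow> 'v) \<Rightarrow> bool"
where
  "lie_algebra scale br \<longleftrightarrow>
     fin_dim_vector_space scale \<and>
     bilinear_map scale scale br \<and>
     (\<forall>x. br x x = 0) \<and>
     (\<forall>x y z. br x (br y z) + br y (br z x) + br z (br x y) = 0)"

text \<open>For a symmetric form the left and right radicals coincide, so non-degeneracy is stated for one side.\<close>

definition sym_nondegenerate_form ::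
  "('f::field \<Rightarrow> 'v::ab_group_add \<Rightarrow> 'v) \<Rightarrow> ('v \<Rightarrow> 'v \<Rightarrow> 'f) \<Rightarrow> bool"
where
  "sym_nondegenerate_form scale B \<longleftrightarrow>
     bilinear_map scale (*) B \<and>
     (\<forall>x y. B x y = B y x) \<and>
     (\<forall>x. (\<forall>y. B x y = 0) \<longrightarrow> x = 0)"

definition invariant_form :: "('v \<Rightarrow> 'v \<Rightarrow> 'v) \<Rightarrow> ('v \<Rightarrow> 'v \<Rightarrow> 'f) \<Rightarrow> bool" where
  "invariant_form \<mu> B \<longleftrightarrow> (\<forall>x y z. B (\<mu> x y) z = B x (\<mu> y z))"

definition quadratic_hom_lie_algebra ::
  "('f::field \<Rightarrow> 'v::ab_group_add \<Rightarrow> 'v) \<Rightarrow> ('v \<Rightarrow> 'v \<Rightarrow> 'v) \<Rightarrow> ('v \<Rightarrow> 'v) \<Rightarrow> ('v \<Rightarrow> 'v \<Rightarrow> 'f) \<Rightarrow> bool"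
where
  "quadratic_hom_lie_algebra scale \<mu> T B \<longleftrightarrow>
     hom_lie_algebra scale \<mu> T \<and>
     sym_nondegenerate_form scale B \<and>
     invariant_form \<mu> B \<and>
     (\<forall>x y. B (T x) y = B x (T y))"

definition quadratic_lie_algebra ::
  "('f::field \<Rightarrow> 'v::ab_group_add \<Rightarrow> 'v) \<Rightarrow> ('v \<Rightarrow> 'v \<Rightarrow> 'v) \<Rightarrow> ('v \<Rightarrow> 'v \<Rightarrow> 'f) \<Rightarrow> bool"
where
  "quadratic_lie_algebra scale br B \<longleftrightarrow>
     lie_algebra scale br \<and>
     sym_nondegenerate_form scale B \<and>
     invariant_form br B"

end

theory Submission
  imports Defs
begin

text \<open>
  The centroid condition and skew-symmetry let \<open>T\<close> pass through either argument of \<open>\<mu>\<close>, so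
  \<open>[x, [y, z]] = T (\<mu> (T x) (\<mu> y z))\<close> and the Jacobi sum of the new bracket is \<open>T\<close> applied to the
  Hom-Jacobi sum of \<open>\<mu>\<close>.
\<close>

text \<open>Turns skew-symmetry into the alternating law that \<open>lie_algebra\<close> demands;
  characteristic zero supplies \<open>2 \<noteq> 0\<close>.\<close>

lemma (in vector_space) eq_uminus_self_imp_zero:
  assumes "(2::'a) \<noteq> 0" and "(v::'b) = - v"
  shows "v = 0"
proof -
  have "2 *s v = v + v"
    using scale_left_distrib[of 1 1 v] by simp
  also have "\<dots> = 0"
    using assms(2) by (metis add.right_inverse)
  finally show ?thesis
    using assms(1) by simp
qed

text \<open>Swap the arguments, apply the centroid condition on the left, and swap back; the two
  signs cancel.\<close>

lemma in_centroid_right: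
  assumes "in_centroid \<mu> T" and "\<And>x y. \<mu> x y = - \<mu> y x" and "\<And>x. T (- x) = - T x"
  shows "T (\<mu> x y) = \<mu> x (T y)"
  using assms unfolding in_centroid_def by metis

lemma bilinear_map_compose_linear:
  assumes "bilinear_map s1 s2 f" and "Vector_Spaces.linear s2 s3 g"
  shows "bilinear_map s1 s3 (\<lambda>x y. g (f x y))"
  using assms Vector_Spaces.linear_compose[of s1 s2 _ s3 g] unfolding bilinear_map_def comp_def by blast

theorem proposition1p1:
  fixes scale :: "'f::{alg_closed_field,field_char_0} \<Rightarrow> 'v::ab_group_add \<Rightarrow> 'v"
    and \<mu> :: "'v \<Rightarrow> 'v \<Rightarrow> 'v"
    and T :: "'v \<Rightarrow> 'v"
    and B :: "'v \<Rightarrow> 'v \<Rightarrow> 'f"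
    and br :: "'v \<Rightarrow> 'v \<Rightarrow> 'v"
  assumes "quadratic_hom_lie_algebra scale \<mu> T B"
    and "in_centroid \<mu> T"
    and "\<And>x y. br x y = T (\<mu> x y)"
  shows "quadratic_lie_algebra scale br B \<and> (\<forall>x y. T (br x y) = br (T x) y)"
proof -
  have fin: "fin_dim_vector_space scale"
    and bil: "bilinear_map scale scale \<mu>"
    and skew: "\<And>x y. \<mu> x y = - \<mu> y x"
    and lin: "Vector_Spaces.linear scale scale T"
    and hom_jacobi: "\<And>x y z. \<mu> (T x) (\<mu> y z) + \<mu> (T y) (\<mu> z x) + \<mu> (T z) (\<mu> x y) = 0"
    and form: "sym_nondegenerate_form scale B"
    and inv: "\<And>x y z. B (\<mu> x y) z = B x (\<mu> y z)"
    and adj: "\<And>x y. B (T x) y = B x (T y)"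
    using assms(1)
    unfolding quadratic_hom_lie_algebra_def hom_lie_algebra_def invariant_form_def by blast+
  interpret T: Vector_Spaces.linear scale scale T by (rule lin)
  have left: "T (\<mu> x y) = \<mu> (T x) y" for x y
    using assms(2) by (simp add: in_centroid_def)
  have right: "T (\<mu> x y) = \<mu> x (T y)" for x y
    using assms(2) skew T.neg by (rule in_centroid_right)
  have br_eq: "br = (\<lambda>x y. T (\<mu> x y))"
    using assms(3) by blast
  have "bilinear_map scale scale br"
    unfolding br_eq using bil lin by (rule bilinear_map_compose_linear)
  moreover have "br x x = 0" for x
    using T.vs1.eq_uminus_self_imp_zero[OF _ skew[of x x]] by (simp add: assms(3) T.zero)
  moreover have "br x (br y z) + br y (br z x) + br z (br x y) = 0" for x y z
  proof -
    \<comment> \<open>Pulling every \<open>T\<close> outwards brings both sides to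
      \<open>T (T (\<mu> a (\<mu> b c)))\<close>.\<close>
    have "br a (br b c) = T (\<mu> (T a) (\<mu> b c))" for a b c
      by (simp only: assms(3) left[symmetric] right[symmetric])
    then show ?thesis
      by (simp add: T.add[symmetric] hom_jacobi T.zero)
  qed
  moreover have "invariant_form br B"
    \<comment> \<open>\<open>T\<close> moves across \<open>B\<close> onto \<open>z\<close>,
      invariance of \<open>\<mu>\<close> regroups to \<open>B x (\<mu> y (T z))\<close>, and
      \<open>right\<close> pulls \<open>T\<close> out of the product.\<close>
    unfolding invariant_form_def assms(3) by (metis adj inv right)
  moreover have "T (br x y) = br (T x) y" for x y
    by (simp add: assms(3) left)
  ultimately show ?thesis
    using fin form unfolding quadratic_lie_algebra_def lie_algebra_def by blast
qed

end
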